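(* Let $H$ be a real or complex Hilbert space, $J \geq 2$ an integer, and $M_1,\dots ,M_J$ a family of closed subspaces of $H$. For each $j \in \{1,\dots ,J\}$, let $P_j$ be the orthogonal projection onto $M_j$, and let $(j_n)_{n\ge 1}$ be any sequence taking values in $\{1,\dots,J\}$. Let $x_0 \in H$ be a vector, and let $(x_n)_{n\geq 0}$ be the sequence defined by $$x_n = P_{j_n}x_{n-1}, \quad n\geq1.$$ Then $x_n$ converges weakly as $n\to \infty$. *)

theory Defs
  imports "HOL-Analysis.Analysis"
begin

(* A real Hilbert space is a type of sort {real_inner, complete_space}. The libraries have no
   complex inner product. A complex inner product space is declared on top of the class of its
   underlying real inner product space, whose inner product is the real part of cinner: this fixes
   the norm, metric and topology to be those induced by cinner (see norm_eq_sqrt_cinner).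
   Definiteness of cinner is inherited from real_inner (see cinner_self_nonneg, cinner_eq_zero_iff).
   The form cinner is linear in its first argument. *)
class complex_inner = real_inner +
  fixes scaleC :: "complex \<Rightarrow> 'a \<Rightarrow> 'a"  (infixr \<open>*\<^sub>C\<close> 75)
    and cinner :: "'a \<Rightarrow> 'a \<Rightarrow> complex"
  assumes scaleC_add_right: "a *\<^sub>C (x + y) = a *\<^sub>C x + a *\<^sub>C y"
    and scaleC_add_left: "(a + b) *\<^sub>C x = a *\<^sub>C x + b *\<^sub>C x"
    and scaleC_scaleC: "a *\<^sub>C (b *\<^sub>C x) = (a * b) *\<^sub>C x"
    and scaleC_of_real: "complex_of_real r *\<^sub>C x = r *\<^sub>R x"
    and cinner_commute: "cinner x y = cnj (cinner y x)"
    and cinner_add_left: "cinner (x + y) z = cinner x z + cinner y z"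
    and cinner_scaleC_left: "cinner (a *\<^sub>C x) y = a * cinner x y"
    and inner_eq_Re_cinner: "inner x y = Re (cinner x y)"

class complex_hilbert = complex_inner + complete_space

lemma cinner_self_nonneg:
  "cinner x x = complex_of_real (inner x x)" "0 \<le> Re (cinner x x)" "Im (cinner x x) = 0"
proof -
  have "cinner x x = cnj (cinner x x)"
    by (rule cinner_commute)
  then show "Im (cinner x x) = 0"
    by (simp add: complex_eq_iff)
  then show "cinner x x = complex_of_real (inner x x)"
    by (simp add: complex_eq_iff inner_eq_Re_cinner)
  show "0 \<le> Re (cinner x x)"
    by (simp add: inner_eq_Re_cinner [symmetric])
qed

lemma cinner_eq_zero_iff: "cinner x x = 0 \<longleftrightarrow> x = 0"
  by (simp add: cinner_self_nonneg(1))

lemma norm_eq_sqrt_cinner: "norm x = sqrt (cmod (cinner x x))"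
  by (simp add: cinner_self_nonneg(1) norm_eq_sqrt_inner [of x])

global_interpretation complex_vector: vector_space "scaleC :: complex \<Rightarrow> 'a \<Rightarrow> 'a::complex_inner"
  defines csubspace = complex_vector.subspace
proof
  show "1 *\<^sub>C x = x" for x :: 'a
    using scaleC_of_real [of 1 x] by simp
qed (simp_all add: scaleC_add_right scaleC_add_left scaleC_scaleC)

instantiation complex :: complex_hilbert
begin

definition scaleC_complex :: "complex \<Rightarrow> complex \<Rightarrow> complex" where
  "scaleC_complex a x = a * x"

definition cinner_complex :: "complex \<Rightarrow> complex \<Rightarrow> complex" where
  "cinner_complex x y = x * cnj y"

instance
  by standard
    (auto simp: scaleC_complex_def cinner_complex_def inner_complex_def scaleR_conv_of_real
      algebra_simps)

end

(* For a closed subspace M of a Hilbert space, the vector p described below exists and is unique. *)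
definition orth_proj :: "'a::real_inner set \<Rightarrow> 'a \<Rightarrow> 'a" where
  "orth_proj M x = (THE p. p \<in> M \<and> (\<forall>m\<in>M. inner (x - p) m = 0))"

definition corth_proj :: "'a::complex_inner set \<Rightarrow> 'a \<Rightarrow> 'a" where
  "corth_proj M x = (THE p. p \<in> M \<and> (\<forall>m\<in>M. cinner (x - p) m = 0))"

definition weakly_tends_to :: "(nat \<Rightarrow> 'a::real_normed_vector) \<Rightarrow> 'a \<Rightarrow> bool" where
  "weakly_tends_to x l \<longleftrightarrow>
     (\<forall>f :: 'a \<Rightarrow> real. bounded_linear f \<longrightarrow> (\<lambda>n. f (x n)) \<longlonglongrightarrow> f l)"

definition bounded_cfunctional :: "('a::complex_inner \<Rightarrow> complex) \<Rightarrow> bool" where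
  "bounded_cfunctional f \<longleftrightarrow>
     Vector_Spaces.linear scaleC (*) f \<and> (\<exists>K. \<forall>x. cmod (f x) \<le> norm x * K)"

definition cweakly_tends_to :: "(nat \<Rightarrow> 'a::complex_inner) \<Rightarrow> 'a \<Rightarrow> bool" where
  "cweakly_tends_to x l \<longleftrightarrow>
     (\<forall>f :: 'a \<Rightarrow> complex. bounded_cfunctional f \<longrightarrow> (\<lambda>n. f (x n)) \<longlonglongrightarrow> f l)"

end

theory Submission
  imports Defs
begin

text \<open>
  The argument is that of Amemiya and Ando. Claim: for a finite family of projections, if \<open>A\<close> is a
  word in the projections and \<open>x\<close> stays bounded, then \<open>\<parallel>x\<parallel>\<^sup>2 - \<parallel>A x\<parallel>\<^sup>2 \<rightarrow> 0\<close> forces \<open>x - A x \<rightarrow> 0\<close>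
  weakly, uniformly over all words. Since \<open>\<parallel>x\<^sub>n\<parallel>\<close> decreases, the claim makes \<open>(x\<^sub>n)\<close> weakly Cauchy.
  The claim is proved by induction on the number of projections. The vectors \<open>h\<close> with
  \<open>\<langle>x - A x, h\<rangle> \<rightarrow> 0\<close> form a closed subspace, which contains the intersection of all \<open>M i\<close> (there
  \<open>\<langle>A x, h\<rangle> = \<langle>x, h\<rangle>\<close>). It also contains the orthogonal complement of each \<open>M i\<close>: cutting \<open>A\<close> at
  the first and at the last occurrence of \<open>i\<close>, the induction hypothesis for the pieces without \<open>i\<close>
  shows that \<open>x\<close> and \<open>A x\<close> are both weakly close to \<open>M i\<close>. Together these subspaces span a dense
  subspace.
\<close>

section \<open>Orthogonal projections onto closed subspaces\<close>

text \<open>A minimising sequence in \<open>M\<close> is Cauchy by the parallelogram law, and its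
  limit stays in \<open>M\<close> because \<open>M\<close> is closed.\<close>

lemma closed_subspace_nearest_point:
  fixes M :: "'a::{real_inner,complete_space} set"
  assumes M: "subspace M" "closed M"
  obtains p where "p \<in> M" "\<And>m. m \<in> M \<Longrightarrow> norm (x - p) \<le> norm (x - m)"
proof -
  define d where "d = (INF m\<in>M. (norm (x - m))\<^sup>2)"
  have bdd: "bdd_below ((\<lambda>m. (norm (x - m))\<^sup>2) ` M)"
    by (rule bdd_belowI2 [of _ 0]) simp
  have ne: "M \<noteq> {}" using subspace_0 [OF M(1)] by auto
  have d_le: "d \<le> (norm (x - m))\<^sup>2" if "m \<in> M" for m
    unfolding d_def by (rule cINF_lower [OF bdd that])
  have "\<exists>m\<in>M. (norm (x - m))\<^sup>2 < d + inverse (real (Suc n))" for n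
    using cINF_less_iff [OF ne bdd, of "d + inverse (real (Suc n))"] by (simp add: d_def)
  then obtain u where uM: "\<And>n. u n \<in> M"
    and u: "\<And>n. (norm (x - u n))\<^sup>2 < d + inverse (real (Suc n))"
    by metis
  have par: "(norm (u m - u n))\<^sup>2 \<le> 2 * inverse (real (Suc m)) + 2 * inverse (real (Suc n))"
    for m n
  proof -
    have "(1/2) *\<^sub>R (u m + u n) \<in> M"
      using M(1) uM by (simp add: subspace_add subspace_scale)
    then have "d \<le> (norm (x - (1/2) *\<^sub>R (u m + u n)))\<^sup>2" by (rule d_le)
    \<comment> \<open>Parallelogram law for \<open>x - u m\<close> and \<open>x - u n\<close>. The
      midpoint lies in \<open>M\<close>, so its term is at least \<open>4 * d\<close>, which cancels
      the two copies of \<open>2 * d\<close> on the right.\<close>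
    moreover have "(norm (u m - u n))\<^sup>2 + 4 * (norm (x - (1/2) *\<^sub>R (u m + u n)))\<^sup>2
        = 2 * (norm (x - u m))\<^sup>2 + 2 * (norm (x - u n))\<^sup>2"
      by (simp add: power2_norm_eq_inner inner_simps inner_commute algebra_simps)
    ultimately show ?thesis using u [of m] u [of n] by simp
  qed
  have "Cauchy u"
  proof (rule metric_CauchyI)
    fix e :: real assume e: "0 < e"
    then obtain k where k: "inverse (real (Suc k)) < e\<^sup>2 / 4"
      using reals_Archimedean [of "e\<^sup>2/4"] by auto
    have "dist (u m) (u n) < e" if "k \<le> m" "k \<le> n" for m n
    proof -
      have "inverse (real (Suc m)) \<le> inverse (real (Suc k))"
        "inverse (real (Suc n)) \<le> inverse (real (Suc k))"
        using that by (auto intro!: le_imp_inverse_le)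
      with par [of m n] k have "(norm (u m - u n))\<^sup>2 < e\<^sup>2" by linarith
      then show ?thesis using e by (simp add: dist_norm power2_less_imp_less)
    qed
    then show "\<exists>k. \<forall>m\<ge>k. \<forall>n\<ge>k. dist (u m) (u n) < e" by blast
  qed
  then obtain p where p: "u \<longlonglongrightarrow> p"
    using Cauchy_convergent convergent_def by blast
  have "p \<in> M" using M(2) uM p by (rule closed_sequentially)
  moreover have "norm (x - p) \<le> norm (x - m)" if "m \<in> M" for m
  proof -
    have "(\<lambda>n. (norm (x - u n))\<^sup>2) \<longlonglongrightarrow> (norm (x - p))\<^sup>2"
      by (intro tendsto_intros p)
    moreover have "(\<lambda>n. d + inverse (real (Suc n))) \<longlonglongrightarrow> d + 0"
      by (intro tendsto_intros LIMSEQ_inverse_real_of_nat)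
    ultimately have "(norm (x - p))\<^sup>2 \<le> d + 0"
      by (rule LIMSEQ_le) (use u in \<open>auto intro: less_imp_le\<close>)
    with d_le [OF that] have "(norm (x - p))\<^sup>2 \<le> (norm (x - m))\<^sup>2" by linarith
    then show ?thesis by (rule power2_le_imp_le) simp
  qed
  ultimately show thesis by (rule that)
qed

text \<open>This justifies the definite description in \<open>orth_proj\<close>. The nearest point
  has an orthogonal residual; the difference of two candidates lies in \<open>M\<close> and is
  orthogonal to itself.\<close>

lemma orth_proj_exists:
  fixes M :: "'a::{real_inner,complete_space} set"
  assumes M: "subspace M" "closed M"
  shows "\<exists>!p. p \<in> M \<and> (\<forall>m\<in>M. inner (x - p) m = 0)"
proof -
  obtain p where p: "p \<in> M" and min: "\<And>m. m \<in> M \<Longrightarrow> norm (x - p) \<le> norm (x - m)"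
    using closed_subspace_nearest_point [OF M] by metis
  have orth: "inner (x - p) m = 0" if m: "m \<in> M" for m
  proof (cases "m = 0")
    case False
    \<comment> \<open>The minimiser of the quadratic \<open>norm (x - p - t m)\<close> squared. It
      lowers the value by the square of \<open>inner (x - p) m\<close> over
      \<open>inner m m\<close>, and minimality of \<open>p\<close> forbids a positive drop.\<close>
    define t where "t = inner (x - p) m / inner m m"
    have mm: "inner m m > 0" using False by simp
    have "p + t *\<^sub>R m \<in> M" using M(1) p m by (simp add: subspace_add subspace_scale)
    then have "(norm (x - p))\<^sup>2 \<le> (norm (x - (p + t *\<^sub>R m)))\<^sup>2"
      using min by (simp add: power_mono)
    also have "\<dots> = (norm (x - p))\<^sup>2 - 2 * t * inner (x - p) m + t\<^sup>2 * inner m m"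
      unfolding power2_norm_eq_inner
      by (simp add: inner_simps inner_commute algebra_simps power2_eq_square)
    also have "t\<^sup>2 * inner m m = t * inner (x - p) m"
      using mm by (simp add: t_def power2_eq_square)
    finally have "(inner (x - p) m)\<^sup>2 / inner m m \<le> 0"
      by (simp add: t_def power2_eq_square)
    then show ?thesis using mm by (simp add: divide_le_0_iff)
  qed simp
  show ?thesis
  proof (rule ex1I [of _ p])
    show "p \<in> M \<and> (\<forall>m\<in>M. inner (x - p) m = 0)" using p orth by blast
    fix q assume q: "q \<in> M \<and> (\<forall>m\<in>M. inner (x - q) m = 0)"
    have "q - p \<in> M" using M(1) p q by (simp add: subspace_diff)
    then have "inner (x - p) (q - p) - inner (x - q) (q - p) = 0" using orth q by simp
    then have "inner (q - p) (q - p) = 0" by (simp add: inner_simps)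
    then show "q = p" by simp
  qed
qed

lemma orth_proj:
  fixes M :: "'a::{real_inner,complete_space} set"
  assumes "subspace M" "closed M"
  shows orth_proj_mem: "orth_proj M x \<in> M"
    and orth_proj_orthogonal: "m \<in> M \<Longrightarrow> inner (x - orth_proj M x) m = 0"
  using theI' [OF orth_proj_exists [OF assms, of x]] unfolding orth_proj_def by blast+

text \<open>Pythagoras. It turns a small drop of the squared norm into a small displacement.\<close>

lemma norm_orth_proj:
  fixes M :: "'a::{real_inner,complete_space} set"
  assumes "subspace M" "closed M"
  shows "(norm (x - orth_proj M x))\<^sup>2 = (norm x)\<^sup>2 - (norm (orth_proj M x))\<^sup>2"
  using orth_proj_orthogonal [OF assms orth_proj_mem [OF assms], of x x]
  unfolding power2_norm_eq_inner by (simp add: inner_simps inner_commute)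

section \<open>Density criterion, Riesz representation and weak limits\<close>

lemma closed_subspace_eq_UNIV:
  fixes V :: "'a::{real_inner,complete_space} set"
  assumes V: "subspace V" "closed V" and "\<And>v. (\<And>h. h \<in> V \<Longrightarrow> inner v h = 0) \<Longrightarrow> v = 0"
  shows "V = UNIV"
proof -
  have "x - orth_proj V x = 0" for x
    using assms(3) orth_proj_orthogonal [OF V] by blast
  then show ?thesis using orth_proj_mem [OF V] by (metis UNIV_eq_I right_minus_eq)
qed

text \<open>Riesz representation: a nonzero \<open>f\<close> has a closed kernel \<open>K\<close>,
  and a suitable multiple of a vector orthogonal to \<open>K\<close> represents
  \<open>f\<close>.\<close>

lemma bounded_linear_eq_inner:
  fixes f :: "'a::{real_inner,complete_space} \<Rightarrow> real"
  assumes f: "bounded_linear f"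
  obtains l where "\<And>x. f x = inner l x"
proof (cases "\<forall>x. f x = 0")
  case True
  then show thesis using that [of 0] by simp
next
  case False
  then obtain z where z: "f z \<noteq> 0" by blast
  interpret bounded_linear f by fact
  define K where "K = {x. f x = 0}"
  have K: "subspace K" "closed K"
    unfolding K_def
    by (auto simp: subspace_def add scaleR zero
      intro!: closed_Collect_eq continuous_on continuous_intros)
  define v where "v = z - orth_proj K z"
  have fv: "f v = f z" using orth_proj_mem [OF K, of z] by (simp add: v_def diff K_def)
  then have "v \<noteq> 0" using z zero by auto
  \<comment> \<open>The coefficient makes both sides agree at \<open>v\<close>. Every
    \<open>x\<close> is a multiple of \<open>v\<close> plus an element of \<open>K\<close>, on which
    both sides vanish.\<close>
  have "f x = inner ((f v / inner v v) *\<^sub>R v) x" for x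
  proof -
    have "x - (f x / f v) *\<^sub>R v \<in> K" using z fv by (simp add: K_def diff scaleR)
    then have "inner v (x - (f x / f v) *\<^sub>R v) = 0"
      unfolding v_def by (rule orth_proj_orthogonal [OF K])
    then show ?thesis using z fv \<open>v \<noteq> 0\<close> by (simp add: inner_simps field_simps)
  qed
  then show thesis by (rule that)
qed

lemma weakly_tends_to_inner:
  fixes x :: "nat \<Rightarrow> 'a::{real_inner,complete_space}"
  assumes "\<And>h. (\<lambda>n. inner (x n) h) \<longlonglongrightarrow> inner l h"
  shows "weakly_tends_to x l"
  unfolding weakly_tends_to_def
proof (intro allI impI)
  fix f :: "'a \<Rightarrow> real" assume "bounded_linear f"
  then obtain h where "\<And>x. f x = inner h x" using bounded_linear_eq_inner by blast
  then show "(\<lambda>n. f (x n)) \<longlonglongrightarrow> f l" using assms [of h] by (simp add: inner_commute)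
qed

text \<open>The pointwise limit of the functionals \<open>inner (x n)\<close> is linear and bounded
  by \<open>R\<close>, so the Riesz representation supplies the weak limit.\<close>

lemma weakly_convergent_if_inner_convergent:
  fixes x :: "nat \<Rightarrow> 'a::{real_inner,complete_space}"
  assumes R: "\<And>n. norm (x n) \<le> R" and conv: "\<And>h. convergent (\<lambda>n. inner (x n) h)"
  shows "\<exists>l. weakly_tends_to x l"
proof -
  define f where "f h = lim (\<lambda>n. inner (x n) h)" for h
  have f: "(\<lambda>n. inner (x n) h) \<longlonglongrightarrow> f h" for h
    using conv by (simp add: f_def convergent_LIMSEQ_iff)
  have "bounded_linear f"
  proof (rule bounded_linear_intro [where K = R])
    show "f (h + k) = f h + f k" for h k
      using f [of "h + k"] tendsto_add [OF f [of h] f [of k]]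
      by (intro LIMSEQ_unique) (simp_all add: inner_simps)
    show "f (r *\<^sub>R h) = r *\<^sub>R f h" for r h
      using f [of "r *\<^sub>R h"] tendsto_mult_left [OF f [of h], of r]
      by (intro LIMSEQ_unique) (simp_all add: inner_simps)
    show "norm (f h) \<le> norm h * R" for h
    proof (rule LIMSEQ_le_const2 [OF tendsto_norm [OF f]], intro exI allI impI)
      fix n
      have "norm (inner (x n) h) \<le> norm (x n) * norm h"
        by (simp add: Cauchy_Schwarz_ineq2)
      also have "\<dots> \<le> norm h * R"
        using mult_left_mono [OF R norm_ge_zero, of h n] by (simp only: mult.commute)
      finally show "norm (inner (x n) h) \<le> norm h * R" .
    qed
  qed
  then obtain l where "\<And>h. f h = inner l h" using bounded_linear_eq_inner by blast
  then show ?thesis using weakly_tends_to_inner [of x l] f by auto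
qed

section \<open>Words in the projections\<close>

text \<open>With \<open>fold\<close>, the head of the list is the projection applied first, so words
  grow in time from left to right.\<close>

abbreviation proj_word :: "('i \<Rightarrow> 'a::real_inner set) \<Rightarrow> 'i list \<Rightarrow> 'a \<Rightarrow> 'a" where
  "proj_word M w \<equiv> fold (\<lambda>i. orth_proj (M i)) w"

lemma norm_proj_word_le:
  fixes M :: "'i \<Rightarrow> 'a::{real_inner,complete_space} set"
  assumes "\<And>i. i \<in> set w \<Longrightarrow> subspace (M i) \<and> closed (M i)"
  shows "norm (proj_word M w x) \<le> norm x"
  using assms
proof (induction w arbitrary: x)
  case (Cons i w)
  have "0 \<le> (norm x)\<^sup>2 - (norm (orth_proj (M i) x))\<^sup>2"
    using Cons.prems [of i] norm_orth_proj [of "M i" x] by (metis list.set_intros(1) zero_le_power2)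
  then have "norm (orth_proj (M i) x) \<le> norm x"
    by (intro power2_le_imp_le [OF _ norm_ge_zero]) simp
  moreover have "norm (proj_word M w (orth_proj (M i) x)) \<le> norm (orth_proj (M i) x)"
    using Cons by auto
  ultimately show ?case by simp
qed simp

lemma inner_proj_word:
  fixes M :: "'i \<Rightarrow> 'a::{real_inner,complete_space} set"
  assumes "\<And>i. i \<in> set w \<Longrightarrow> subspace (M i) \<and> closed (M i)"
    and "\<And>i. i \<in> set w \<Longrightarrow> h \<in> M i"
  shows "inner (proj_word M w x) h = inner x h"
  using assms
proof (induction w arbitrary: x)
  case (Cons i w)
  then have "inner (x - orth_proj (M i) x) h = 0"
    by (intro orth_proj_orthogonal) auto
  then show ?case using Cons by (simp add: inner_simps)
qed simp

section \<open>Test vectors against which words are weakly stable\<close>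

text \<open>The epsilon-delta form of the claim for one test vector \<open>h\<close>. The threshold
  \<open>d\<close> depends on neither the word nor the point of the ball; this uniformity is what
  lets the induction apply it to pieces of a word.\<close>

definition weakly_stable :: "('i \<Rightarrow> 'a::real_inner set) \<Rightarrow> 'i set \<Rightarrow> real \<Rightarrow> 'a set" where
  "weakly_stable M S R = {h. \<forall>e>0. \<exists>d>0. \<forall>x w. norm x \<le> R \<longrightarrow> set w \<subseteq> S \<longrightarrow>
     (norm x)\<^sup>2 - (norm (proj_word M w x))\<^sup>2 \<le> d \<longrightarrow> \<bar>inner (x - proj_word M w x) h\<bar> \<le> e}"

lemma weakly_stableI:
  assumes "\<And>e. e > 0 \<Longrightarrow> \<exists>d>0. \<forall>x w. norm x \<le> R \<longrightarrow> set w \<subseteq> S \<longrightarrow>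
     (norm x)\<^sup>2 - (norm (proj_word M w x))\<^sup>2 \<le> d \<longrightarrow> \<bar>inner (x - proj_word M w x) h\<bar> \<le> e"
  shows "h \<in> weakly_stable M S R"
  using assms by (simp add: weakly_stable_def)

lemma weakly_stableE:
  assumes "h \<in> weakly_stable M S R" "e > 0"
  obtains d where "d > 0" "\<And>x w. norm x \<le> R \<Longrightarrow> set w \<subseteq> S \<Longrightarrow>
     (norm x)\<^sup>2 - (norm (proj_word M w x))\<^sup>2 \<le> d \<Longrightarrow> \<bar>inner (x - proj_word M w x) h\<bar> \<le> e"
  using assms unfolding weakly_stable_def by blast

lemma subspace_weakly_stable: "subspace (weakly_stable M S R)"
proof (rule subspaceI)
  show "0 \<in> weakly_stable M S R" by (auto intro!: weakly_stableI exI [of _ 1])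
next
  fix h k assume hk: "h \<in> weakly_stable M S R" "k \<in> weakly_stable M S R"
  show "h + k \<in> weakly_stable M S R"
  proof (rule weakly_stableI)
    fix e :: real assume "e > 0"
    then have e2: "e / 2 > 0" by simp
    obtain d1 where d1: "d1 > 0" "\<And>x w. norm x \<le> R \<Longrightarrow> set w \<subseteq> S \<Longrightarrow>
       (norm x)\<^sup>2 - (norm (proj_word M w x))\<^sup>2 \<le> d1 \<Longrightarrow> \<bar>inner (x - proj_word M w x) h\<bar> \<le> e / 2"
      using weakly_stableE [OF hk(1) e2] by blast
    obtain d2 where d2: "d2 > 0" "\<And>x w. norm x \<le> R \<Longrightarrow> set w \<subseteq> S \<Longrightarrow>
       (norm x)\<^sup>2 - (norm (proj_word M w x))\<^sup>2 \<le> d2 \<Longrightarrow> \<bar>inner (x - proj_word M w x) k\<bar> \<le> e / 2"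
      using weakly_stableE [OF hk(2) e2] by blast
    have "\<bar>inner (x - proj_word M w x) (h + k)\<bar> \<le> e"
      if "norm x \<le> R" "set w \<subseteq> S" "(norm x)\<^sup>2 - (norm (proj_word M w x))\<^sup>2 \<le> min d1 d2" for x w
      using d1(2) [of x w] d2(2) [of x w] that by (simp add: inner_add_right)
    then show "\<exists>d>0. \<forall>x w. norm x \<le> R \<longrightarrow> set w \<subseteq> S \<longrightarrow>
       (norm x)\<^sup>2 - (norm (proj_word M w x))\<^sup>2 \<le> d \<longrightarrow> \<bar>inner (x - proj_word M w x) (h + k)\<bar> \<le> e"
      using d1(1) d2(1) by (intro exI [of _ "min d1 d2"]) simp
  qed
next
  fix c :: real and h assume h: "h \<in> weakly_stable M S R"
  show "c *\<^sub>R h \<in> weakly_stable M S R"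
  proof (rule weakly_stableI)
    fix e :: real assume "e > 0"
    \<comment> \<open>The summand 1 covers \<open>c = 0\<close>.\<close>
    then have "e / (\<bar>c\<bar> + 1) > 0" by simp
    then obtain d where d: "d > 0" "\<And>x w. norm x \<le> R \<Longrightarrow> set w \<subseteq> S \<Longrightarrow>
       (norm x)\<^sup>2 - (norm (proj_word M w x))\<^sup>2 \<le> d \<Longrightarrow>
       \<bar>inner (x - proj_word M w x) h\<bar> \<le> e / (\<bar>c\<bar> + 1)"
      using weakly_stableE [OF h] by blast
    have "\<bar>inner (x - proj_word M w x) (c *\<^sub>R h)\<bar> \<le> e"
      if "norm x \<le> R" "set w \<subseteq> S" "(norm x)\<^sup>2 - (norm (proj_word M w x))\<^sup>2 \<le> d" for x w
    proof -
      have "\<bar>inner (x - proj_word M w x) (c *\<^sub>R h)\<bar> = \<bar>c\<bar> * \<bar>inner (x - proj_word M w x) h\<bar>"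
        by (simp add: abs_mult)
      also have "\<dots> \<le> (\<bar>c\<bar> + 1) * (e / (\<bar>c\<bar> + 1))"
        by (intro mult_mono d(2) that) auto
      finally show ?thesis by simp
    qed
    then show "\<exists>d>0. \<forall>x w. norm x \<le> R \<longrightarrow> set w \<subseteq> S \<longrightarrow>
       (norm x)\<^sup>2 - (norm (proj_word M w x))\<^sup>2 \<le> d \<longrightarrow> \<bar>inner (x - proj_word M w x) (c *\<^sub>R h)\<bar> \<le> e"
      using d(1) by blast
  qed
qed

text \<open>Words are contractions, so \<open>x - proj_word M w x\<close> has norm at most
  \<open>2 * \<bar>R\<bar>\<close>, and replacing \<open>h\<close> by a nearby stable
  \<open>k\<close> costs a uniformly small error.\<close>

lemma closed_weakly_stable:
  fixes M :: "'i \<Rightarrow> 'a::{real_inner,complete_space} set"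
  assumes M: "\<And>i. i \<in> S \<Longrightarrow> subspace (M i) \<and> closed (M i)"
  shows "closed (weakly_stable M S R)"
proof -
  have "h \<in> weakly_stable M S R" if h: "h \<in> closure (weakly_stable M S R)" for h
  proof (rule weakly_stableI)
    fix e :: real assume e: "e > 0"
    define r where "r = e / 2 / (2 * \<bar>R\<bar> + 1)"
    have r: "r > 0" and Rr: "2 * \<bar>R\<bar> * r \<le> e / 2"
      using e by (auto simp: r_def field_simps)
    obtain k where k: "k \<in> weakly_stable M S R" "dist k h < r"
      using h r by (meson closure_approachable)
    have "e / 2 > 0" using e by simp
    with k(1) obtain d where d: "d > 0" "\<And>x w. norm x \<le> R \<Longrightarrow> set w \<subseteq> S \<Longrightarrow>
       (norm x)\<^sup>2 - (norm (proj_word M w x))\<^sup>2 \<le> d \<Longrightarrow> \<bar>inner (x - proj_word M w x) k\<bar> \<le> e / 2"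
      using weakly_stableE by blast
    have "\<bar>inner (x - proj_word M w x) h\<bar> \<le> e"
      if x: "norm x \<le> R" and w: "set w \<subseteq> S"
        and dx: "(norm x)\<^sup>2 - (norm (proj_word M w x))\<^sup>2 \<le> d" for x w
    proof -
      let ?y = "x - proj_word M w x"
      have "norm (proj_word M w x) \<le> norm x" using M w by (intro norm_proj_word_le) auto
      then have "norm ?y \<le> 2 * \<bar>R\<bar>" using x norm_triangle_ineq4 [of x "proj_word M w x"] by linarith
      then have "\<bar>inner ?y (h - k)\<bar> \<le> 2 * \<bar>R\<bar> * r"
        using k(2) Cauchy_Schwarz_ineq2 [of ?y "h - k"]
        by (smt (verit) dist_norm mult_mono norm_ge_zero norm_minus_commute)
      moreover have "inner ?y h = inner ?y k + inner ?y (h - k)" by (simp add: inner_diff_right)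
      ultimately show ?thesis using d(2) [OF x w dx] Rr by linarith
    qed
    then show "\<exists>d>0. \<forall>x w. norm x \<le> R \<longrightarrow> set w \<subseteq> S \<longrightarrow>
       (norm x)\<^sup>2 - (norm (proj_word M w x))\<^sup>2 \<le> d \<longrightarrow> \<bar>inner (x - proj_word M w x) h\<bar> \<le> e"
      using d(1) by blast
  qed
  then show ?thesis by (metis closure_closed closure_subset subsetI subset_antisym closed_closure)
qed

text \<open>With \<open>b\<close> the value just after the first \<open>i\<close> in the word,
  \<open>a\<close> the value just before it and \<open>c\<close> the value just after the last
  \<open>i\<close>, the difference is
  \<open>(x - a) + (a - b) + b - c + (c - proj_word M w x)\<close>. Both \<open>b\<close> and
  \<open>c\<close> lie in \<open>M i\<close> and vanish against \<open>h\<close>. The outer terms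
  come from words without \<open>i\<close>, and \<open>a - b\<close> is small in norm. Whatever
  happens between \<open>b\<close> and \<open>c\<close> is irrelevant.\<close>

lemma orthogonal_complement_weakly_stable:
  fixes M :: "'i \<Rightarrow> 'a::{real_inner,complete_space} set"
  assumes M: "\<And>i. i \<in> S \<Longrightarrow> subspace (M i) \<and> closed (M i)" and i: "i \<in> S"
    and IH: "h \<in> weakly_stable M (S - {i}) R" and h: "\<And>m. m \<in> M i \<Longrightarrow> inner m h = 0"
  shows "h \<in> weakly_stable M S R"
proof (rule weakly_stableI)
  fix e :: real assume e: "e > 0"
  then have "e / 3 > 0" by simp
  with IH obtain d where d: "d > 0" "\<And>x w. norm x \<le> R \<Longrightarrow> set w \<subseteq> S - {i} \<Longrightarrow>
     (norm x)\<^sup>2 - (norm (proj_word M w x))\<^sup>2 \<le> d \<Longrightarrow> \<bar>inner (x - proj_word M w x) h\<bar> \<le> e / 3"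
    using weakly_stableE by blast
  \<comment> \<open>The bound wanted for \<open>norm (a - b)\<close>; the summand 1 covers
    \<open>h = 0\<close>.\<close>
  define r where "r = e / 3 / (norm h + 1)"
  have r: "r > 0" unfolding r_def using e by (simp add: add_nonneg_pos)
  have rh: "r * norm h \<le> e / 3"
  proof -
    have "r * norm h \<le> r * (norm h + 1)" using r by simp
    also have "\<dots> = e / 3"
    proof -
      have "norm h + 1 \<noteq> 0" using norm_ge_zero [of h] by linarith
      then show ?thesis unfolding r_def by (rule nonzero_eq_divide_eq [THEN iffD1]) simp
    qed
    finally show ?thesis .
  qed
  have "\<bar>inner (x - proj_word M w x) h\<bar> \<le> e"
    if x: "norm x \<le> R" and w: "set w \<subseteq> S"
      and dx: "(norm x)\<^sup>2 - (norm (proj_word M w x))\<^sup>2 \<le> min d (r\<^sup>2)" for x w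
  proof (cases "i \<in> set w")
    case False
    then have "\<bar>inner (x - proj_word M w x) h\<bar> \<le> e / 3" using d(2) [OF x] w dx by auto
    then show ?thesis using e by linarith
  next
    case True
    have contr: "norm (proj_word M u z) \<le> norm z" if "set u \<subseteq> S" for u z
      using M that by (intro norm_proj_word_le) auto
    have Pi: "subspace (M i)" "closed (M i)" using M i by auto
    obtain u v where uv: "w = u @ i # v" "i \<notin> set u" using True by (meson split_list_first)
    define a where "a = proj_word M u x"
    define b where "b = orth_proj (M i) a"
    have wb: "proj_word M w x = proj_word M v b" by (simp add: uv a_def b_def)
    have "norm (proj_word M w x) \<le> norm b" using contr [of v b] wb uv w by simp
    then have wb2: "(norm (proj_word M w x))\<^sup>2 \<le> (norm b)\<^sup>2" by (simp add: power_mono)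
    have ba: "(norm (a - b))\<^sup>2 = (norm a)\<^sup>2 - (norm b)\<^sup>2"
      unfolding b_def by (rule norm_orth_proj [OF Pi])
    then have "(norm b)\<^sup>2 \<le> (norm a)\<^sup>2" using zero_le_power2 [of "norm (a - b)"] by linarith
    then have "(norm x)\<^sup>2 - (norm a)\<^sup>2 \<le> d" using wb2 dx by linarith
    then have 1: "\<bar>inner (x - a) h\<bar> \<le> e / 3"
      unfolding a_def using uv w by (intro d(2) x) auto
    have "norm a \<le> norm x" unfolding a_def using uv w by (intro contr) auto
    then have "(norm a)\<^sup>2 \<le> (norm x)\<^sup>2" by (simp add: power_mono)
    \<comment> \<open>Norms never grow along the word, so the drop at this one projection is at most
      the total drop.\<close>
    then have "(norm (a - b))\<^sup>2 \<le> r\<^sup>2" using ba wb2 dx by linarith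
    then have "norm (a - b) \<le> r" by (rule power2_le_imp_le) (use r in simp)
    then have "\<bar>inner (a - b) h\<bar> \<le> r * norm h"
      using Cauchy_Schwarz_ineq2 [of "a - b" h] by (smt (verit) mult_right_mono norm_ge_zero)
    then have 2: "\<bar>inner (a - b) h\<bar> \<le> e / 3" using rh by linarith
    have b0: "inner b h = 0" using h orth_proj_mem [OF Pi] by (simp add: b_def)
    \<comment> \<open>A second, independent cut of the same word: \<open>v\<close> may still contain
      \<open>i\<close>, whereas \<open>t\<close> does not, so the stability assumption for
      \<open>S - {i}\<close> applies to \<open>t\<close> started at \<open>c\<close>.\<close>
    obtain s t where st: "w = s @ i # t" "i \<notin> set t" using True by (meson split_list_last)
    define c where "c = proj_word M (s @ [i]) x"
    have wc: "proj_word M w x = proj_word M t c" by (simp add: st c_def)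
    have c0: "inner c h = 0" using h orth_proj_mem [OF Pi] by (simp add: c_def)
    have "norm c \<le> norm x" unfolding c_def using st w by (intro contr) auto
    then have "norm c \<le> R" "(norm c)\<^sup>2 \<le> (norm x)\<^sup>2" using x by (auto simp: power_mono)
    moreover from this have "(norm c)\<^sup>2 - (norm (proj_word M t c))\<^sup>2 \<le> d"
      using dx [unfolded wc] by linarith
    ultimately have 3: "\<bar>inner (c - proj_word M t c) h\<bar> \<le> e / 3"
      using st w by (intro d(2)) auto
    show ?thesis using 1 2 3 b0 c0 unfolding wc inner_diff_left by linarith
  qed
  then show "\<exists>d>0. \<forall>x w. norm x \<le> R \<longrightarrow> set w \<subseteq> S \<longrightarrow>
     (norm x)\<^sup>2 - (norm (proj_word M w x))\<^sup>2 \<le> d \<longrightarrow> \<bar>inner (x - proj_word M w x) h\<bar> \<le> e"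
    using d(1) r by (intro exI [of _ "min d (r\<^sup>2)"]) simp
qed

text \<open>Let \<open>v\<close> be orthogonal to all stable vectors. The residual of
  \<open>v\<close> at each \<open>M i\<close> is stable, by induction on \<open>S\<close>, and this
  forces \<open>v\<close> into every \<open>M i\<close>. Then \<open>v\<close> is itself stable,
  hence orthogonal to itself.\<close>

lemma weakly_stable_eq_UNIV:
  fixes M :: "'i \<Rightarrow> 'a::{real_inner,complete_space} set"
  assumes "finite S" and "\<And>i. i \<in> S \<Longrightarrow> subspace (M i) \<and> closed (M i)"
  shows "weakly_stable M S R = UNIV"
  using assms
proof (induction S rule: finite_psubset_induct)
  case (psubset S)
  note M = psubset.prems
  show ?case
  proof (rule closed_subspace_eq_UNIV)
    show "subspace (weakly_stable M S R)" by (rule subspace_weakly_stable)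
    show "closed (weakly_stable M S R)" using M by (rule closed_weakly_stable)
    fix v assume v: "\<And>h. h \<in> weakly_stable M S R \<Longrightarrow> inner v h = 0"
    have "v \<in> M i" if i: "i \<in> S" for i
    proof -
      have Mi: "subspace (M i)" "closed (M i)" using M i by auto
      define h where "h = v - orth_proj (M i) v"
      have "weakly_stable M (S - {i}) R = UNIV" using i M by (intro psubset.IH) auto
      then have IH: "h \<in> weakly_stable M (S - {i}) R" by simp
      have orth: "inner m h = 0" if "m \<in> M i" for m
        using orth_proj_orthogonal [OF Mi that] by (simp add: h_def inner_commute)
      have "h \<in> weakly_stable M S R"
        using M i IH orth by (rule orthogonal_complement_weakly_stable)
      then have "inner v h = 0" by (rule v)
      \<comment> \<open>\<open>inner v h\<close> equals \<open>inner h h\<close>, as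
        \<open>h\<close> is orthogonal to the projection of \<open>v\<close>.\<close>
      then have "inner h h = 0"
        using orth [OF orth_proj_mem [OF Mi, of v]] by (simp add: h_def inner_simps)
      then show ?thesis using orth_proj_mem [OF Mi, of v] by (simp add: h_def)
    qed
    then have "inner (proj_word M w x) v = inner x v" if "set w \<subseteq> S" for w x
      using M that by (intro inner_proj_word) auto
    \<comment> \<open>The product with \<open>v\<close> is unchanged by every word, so any threshold
      serves; 1 is arbitrary.\<close>
    then have "v \<in> weakly_stable M S R"
      by (auto intro!: weakly_stableI exI [of _ 1] simp: inner_diff_left)
    then show "v = 0" using v by force
  qed
qed

section \<open>Weak convergence of the iterates\<close>

text \<open>Later iterates are words applied to earlier ones, and the decreasing squared norms have
  arbitrarily small drops from some index on. Stability of every \<open>h\<close> on the ball of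
  radius \<open>norm (x 0)\<close> then makes \<open>inner (x n) h\<close> Cauchy.\<close>

lemma weakly_convergent_orth_proj_iterates:
  fixes M :: "'i \<Rightarrow> 'a::{real_inner,complete_space} set"
  assumes S: "finite S" and M: "\<And>i. i \<in> S \<Longrightarrow> subspace (M i) \<and> closed (M i)"
    and j: "\<And>n. n \<ge> 1 \<Longrightarrow> j n \<in> S"
    and x: "\<And>n. n \<ge> 1 \<Longrightarrow> x n = orth_proj (M (j n)) (x (n - 1))"
  shows "\<exists>l. weakly_tends_to x l"
proof -
  have word: "\<exists>w. set w \<subseteq> S \<and> x n = proj_word M w (x m)" if "m \<le> n" for m n
    using that
  proof (induction n rule: dec_induct)
    case base
    then show ?case by (intro exI [of _ "[]"]) simp
  next
    case (step n)
    then obtain w where "set w \<subseteq> S" "x n = proj_word M w (x m)" by blast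
    then show ?case using x [of "Suc n"] j [of "Suc n"]
      by (intro exI [of _ "w @ [j (Suc n)]"]) simp
  qed
  have mono: "norm (x n) \<le> norm (x m)" if mn: "m \<le> n" for m n
  proof -
    obtain w where w: "set w \<subseteq> S" "x n = proj_word M w (x m)" using word [OF mn] by blast
    then show ?thesis using M norm_proj_word_le [of w M "x m"] by auto
  qed
  have "decseq (\<lambda>n. (norm (x n))\<^sup>2)" by (simp add: decseq_def mono power_mono)
  then obtain L where L: "(\<lambda>n. (norm (x n))\<^sup>2) \<longlonglongrightarrow> L" and Lle: "\<And>n. L \<le> (norm (x n))\<^sup>2"
    using decseq_convergent [of "\<lambda>n. (norm (x n))\<^sup>2" 0] by auto
  have "convergent (\<lambda>n. inner (x n) h)" for h
  proof -
    have "Cauchy (\<lambda>n. inner (x n) h)"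
    proof (rule CauchyI')
      fix e :: real assume "e > 0"
      then have "e / 2 > 0" by simp
      moreover have "h \<in> weakly_stable M S (norm (x 0))"
        using weakly_stable_eq_UNIV [OF S M] by simp
      ultimately obtain d where d: "d > 0" "\<And>z w. norm z \<le> norm (x 0) \<Longrightarrow> set w \<subseteq> S \<Longrightarrow>
         (norm z)\<^sup>2 - (norm (proj_word M w z))\<^sup>2 \<le> d \<Longrightarrow> \<bar>inner (z - proj_word M w z) h\<bar> \<le> e / 2"
        using weakly_stableE by blast
      \<comment> \<open>From index \<open>k\<close> on, all squared norms lie between
        \<open>L\<close> and \<open>L + d\<close>, so any two differ by at most
        \<open>d\<close>.\<close>
      have "L < L + d" using d(1) by simp
      then obtain k where k: "\<And>n. n \<ge> k \<Longrightarrow> (norm (x n))\<^sup>2 < L + d"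
        using order_tendstoD(2) [OF L] unfolding eventually_sequentially by blast
      have "dist (inner (x m) h) (inner (x n) h) < e" if mn: "k \<le> m" "m < n" for m n
      proof -
        obtain w where w: "set w \<subseteq> S" "x n = proj_word M w (x m)"
          using word [of m n] mn by auto
        have "(norm (x m))\<^sup>2 - (norm (x n))\<^sup>2 \<le> d" using k [OF mn(1)] Lle [of n] by linarith
        then have "\<bar>inner (x m - x n) h\<bar> \<le> e / 2"
          unfolding w(2) by (intro d(2) mono w(1)) simp_all
        then show ?thesis using \<open>e > 0\<close> by (simp add: dist_real_def inner_diff_left)
      qed
      then show "\<exists>k. \<forall>m\<ge>k. \<forall>n>m. dist (inner (x m) h) (inner (x n) h) < e" by blast
    qed
    then show ?thesis by (rule Cauchy_convergent)
  qed
  then show ?thesis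
    using weakly_convergent_if_inner_convergent [of x "norm (x 0)"] mono by blast
qed

section \<open>From real to complex scalars\<close>

lemma csubspace_imp_subspace:
  assumes "csubspace N"
  shows "subspace N"
proof (rule subspaceI)
  show "0 \<in> N" using assms by (rule complex_vector.subspace_0)
  show "x + y \<in> N" if "x \<in> N" "y \<in> N" for x y
    using assms that by (rule complex_vector.subspace_add)
  show "c *\<^sub>R x \<in> N" if "x \<in> N" for c x
    using complex_vector.subspace_scale [OF assms that, of "of_real c"]
    by (simp add: scaleC_of_real)
qed

text \<open>Re \<open>\<langle>u, \<i> m\<rangle>\<close> is Im \<open>\<langle>u, m\<rangle>\<close>, so real orthogonality to a complex subspace is complex
  orthogonality.\<close>

lemma csubspace_orthogonal_iff:
  assumes "csubspace N"
  shows "(\<forall>m\<in>N. cinner u m = 0) \<longleftrightarrow> (\<forall>m\<in>N. inner u m = 0)"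
proof
  assume "\<forall>m\<in>N. cinner u m = 0"
  then show "\<forall>m\<in>N. inner u m = 0" by (simp add: inner_eq_Re_cinner)
next
  assume orth: "\<forall>m\<in>N. inner u m = 0"
  show "\<forall>m\<in>N. cinner u m = 0"
  proof
    fix m assume m: "m \<in> N"
    have "\<i> *\<^sub>C m \<in> N" by (rule complex_vector.subspace_scale [OF assms m])
    then have "Re (cinner u (\<i> *\<^sub>C m)) = 0" "Re (cinner u m) = 0"
      using orth m by (simp_all flip: inner_eq_Re_cinner)
    moreover have "cinner u (\<i> *\<^sub>C m) = - \<i> * cinner u m"
      by (metis cinner_commute cinner_scaleC_left complex_cnj_i complex_cnj_mult)
    ultimately show "cinner u m = 0" by (simp add: complex_eq_iff)
  qed
qed

lemma corth_proj_eq_orth_proj: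
  assumes "csubspace N"
  shows "corth_proj N = orth_proj N"
  by (simp add: fun_eq_iff corth_proj_def orth_proj_def csubspace_orthogonal_iff [OF assms])

text \<open>The real and imaginary parts of a bounded complex functional are bounded real
  functionals, and complex limits are taken componentwise.\<close>

lemma weakly_tends_to_imp_cweakly_tends_to:
  assumes y: "weakly_tends_to y l"
  shows "cweakly_tends_to y l"
  unfolding cweakly_tends_to_def
proof (intro allI impI)
  fix f :: "'a \<Rightarrow> complex" assume "bounded_cfunctional f"
  then obtain K where lin: "Vector_Spaces.linear scaleC (*) f" and K: "\<And>x. cmod (f x) \<le> norm x * K"
    unfolding bounded_cfunctional_def by blast
  interpret Vector_Spaces.linear scaleC "(*)" f by (fact lin)
  have "bounded_linear f"
  proof (rule bounded_linear_intro [where K = K])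
    show "f (r *\<^sub>R x) = r *\<^sub>R f x" for r x
      using scale [of "of_real r" x] by (simp add: scaleC_of_real scaleR_conv_of_real)
  qed (use add K in auto)
  then have "bounded_linear (\<lambda>x. Re (f x))" "bounded_linear (\<lambda>x. Im (f x))"
    by (auto intro: bounded_linear_compose bounded_linear_Re bounded_linear_Im)
  then show "(\<lambda>n. f (y n)) \<longlonglongrightarrow> f l"
    using y unfolding weakly_tends_to_def tendsto_complex_iff by blast
qed

theorem theorem5p1:
  fixes J :: nat and j :: "nat \<Rightarrow> nat"
    and M :: "nat \<Rightarrow> 'a::{real_inner,complete_space} set" and x :: "nat \<Rightarrow> 'a"
    and N :: "nat \<Rightarrow> 'b::complex_hilbert set" and y :: "nat \<Rightarrow> 'b"
  assumes "J \<ge> 2"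
    and "\<forall>n\<ge>1. j n \<in> {1..J}"
  shows
    "((\<forall>i\<in>{1..J}. subspace (M i) \<and> closed (M i)) \<and>
      (\<forall>n\<ge>1. x n = orth_proj (M (j n)) (x (n - 1)))
        \<longrightarrow> (\<exists>l. weakly_tends_to x l))
     \<and>
     ((\<forall>i\<in>{1..J}. csubspace (N i) \<and> closed (N i)) \<and>
      (\<forall>n\<ge>1. y n = corth_proj (N (j n)) (y (n - 1)))
        \<longrightarrow> (\<exists>l. cweakly_tends_to y l))"
proof (intro conjI impI)
  assume "(\<forall>i\<in>{1..J}. subspace (M i) \<and> closed (M i)) \<and>
    (\<forall>n\<ge>1. x n = orth_proj (M (j n)) (x (n - 1)))"
  then show "\<exists>l. weakly_tends_to x l"
    using assms(2) by (intro weakly_convergent_orth_proj_iterates [of "{1..J}" M j]) auto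
next
  assume N: "(\<forall>i\<in>{1..J}. csubspace (N i) \<and> closed (N i)) \<and>
    (\<forall>n\<ge>1. y n = corth_proj (N (j n)) (y (n - 1)))"
  \<comment> \<open>The complex iteration is an instance of the real one: each \<open>N i\<close> is
    a real subspace with the same projection.\<close>
  have "\<exists>l. weakly_tends_to y l"
  proof (rule weakly_convergent_orth_proj_iterates [of "{1..J}" N j])
    show "y n = orth_proj (N (j n)) (y (n - 1))" if "n \<ge> 1" for n
      using N assms(2) that by (metis corth_proj_eq_orth_proj)
  qed (use N assms(2) in \<open>auto intro: csubspace_imp_subspace\<close>)
  then show "\<exists>l. cweakly_tends_to y l"
    using weakly_tends_to_imp_cweakly_tends_to by blast
qed

end
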